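(* Let $n\ge 1$ be an integer and let $\mathbb{K}$ be a field of characteristic zero. There exist maps $q_1,\dots,q_n:\mathbb{K}\mathbb{Z}_n\to\mathbb{K}$, where $q_1$ is a linear form and $q_n$ is an $n$-form (a form of degree $n$), such that every element $x=c_1e_1+\dots+c_ne_n\in\mathbb{K}\mathbb{Z}_n$ (with $c_1,\dots,c_n\in\mathbb{K}$) is a root in $\mathbb{K}\mathbb{Z}_n$ of the polynomial $$X^n-q_1(x)X^{n-1}+q_2(x)X^{n-2}-\dots+(-1)^nq_n(x),$$ and moreover $q_1(x)=\operatorname{tr}[\operatorname{circ}(c_1,\dots,c_n)]=nc_1$ and $q_n(x)=\det[\operatorname{circ}(c_1,\dots,c_n)]$.
   Context: $\mathbb{Z}_n$ is the cyclic group of order $n$, with elements $e_1,\dots,e_n$ where $e_i$ is the class of $i-1$; thus $e_ie_j=e_{i+j-1}$ (subscripts mod $n$, taken in $\{1,\dots,n\}$) and $e_1$ is the identity. $\mathbb{K}\mathbb{Z}_n$ is the group algebra, with basis $e_1,\dots,e_n$. For $c_1,\dots,c_n\in\mathbb{K}$, $\operatorname{circ}(c_1,\dots,c_n)$ is the $n\times n$ circulant matrix whose $(i,j)$ entry is $c_{j-i+1}$ (subscripts mod $n$). The form $q_1$ is called the trace and $q_n$ the norm. *)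

theory Defs
  imports
    "HOL-Analysis.Analysis"
    "HOL-Library.Poly_Mapping"
    "HOL-Computational_Algebra.Polynomial"
    "Berlekamp_Zassenhaus.Finite_Field"
begin

text \<open>
  The group \<open>\<int>\<^sub>n\<close> is the additive group of \<open>'n mod_ring\<close>, where \<open>n = CARD('n)\<close>; as \<open>'n\<close> is an
  arbitrary finite type, \<open>n\<close> is an arbitrary positive integer. The multiplication on finitely
  supported functions is convolution over the index monoid, so they form the group algebra:
  \<open>Poly_Mapping.single g k\<close> is the scalar \<open>k\<close> times the basis element \<open>g\<close>, and
  \<open>Poly_Mapping.single 0\<close> is the canonical embedding of the scalars.
\<close>

type_synonym ('n, 'a) cyclic_algebra = "('n mod_ring, 'a) poly_mapping"

definition scale_alg :: "'a \<Rightarrow> ('n::finite, 'a::comm_ring_1) cyclic_algebra \<Rightarrow> ('n, 'a) cyclic_algebra"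
  where "scale_alg k x = Poly_Mapping.map ((*) k) x"

lemma lookup_scale_alg:
  "Poly_Mapping.lookup (scale_alg k x) g = k * Poly_Mapping.lookup x g"
  by (simp add: scale_alg_def Poly_Mapping.map.rep_eq when_def)

lemma vector_space_scale_alg:
  "vector_space (scale_alg :: 'a \<Rightarrow> _ \<Rightarrow> ('n::finite, 'a::field) cyclic_algebra)"
  by standard
    (auto intro!: poly_mapping_eqI simp: lookup_scale_alg lookup_add algebra_simps)

text \<open>The basis is numbered from 1: \<open>basis_elt i\<close> is the residue class of \<open>i - 1\<close>.\<close>

definition basis_elt :: "nat \<Rightarrow> ('n::finite, 'a::comm_ring_1) cyclic_algebra"
  where "basis_elt i = Poly_Mapping.single (of_int_mod_ring (int i - 1)) 1"

lemma basis_elt_mult: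
  assumes "i \<ge> 1" "j \<ge> 1"
  shows "basis_elt i * basis_elt j = (basis_elt (i + j - 1) :: ('n::finite, 'a::comm_ring_1) cyclic_algebra)"
proof -
  have "of_int_mod_ring (int i - 1) + of_int_mod_ring (int j - 1)
      = (of_int_mod_ring (int (i + j - 1) - 1) :: 'n mod_ring)"
    using assms by (transfer, simp add: mod_add_eq of_nat_diff algebra_simps)
  then show ?thesis by (simp add: basis_elt_def mult_single)
qed

lemma basis_elt_mod: "basis_elt (i + CARD('n)) = (basis_elt i :: ('n::finite, 'a::comm_ring_1) cyclic_algebra)"
proof -
  have "of_int_mod_ring (int (i + CARD('n)) - 1) = (of_int_mod_ring (int i - 1) :: 'n mod_ring)"
  proof transfer
    fix i
    have "int (i + CARD('n)) - 1 = (int i - 1) + int CARD('n)" by simp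
    then show "(int (i + CARD('n)) - 1) mod int CARD('n) = (int i - 1) mod int CARD('n)"
      by (metis mod_add_self2)
  qed
  then show ?thesis by (simp add: basis_elt_def)
qed

lemma basis_elt_1: "basis_elt 1 = (1 :: ('n::finite, 'a::comm_ring_1) cyclic_algebra)"
  by (simp add: basis_elt_def)

lemma basis_elt_expansion:
  fixes x :: "('n::finite, 'a::comm_ring_1) cyclic_algebra"
  shows "x = (\<Sum>i=1..CARD('n). scale_alg (c i) (basis_elt i)) \<longleftrightarrow>
    (\<forall>i\<in>{1..CARD('n)}. c i = Poly_Mapping.lookup x (of_int_mod_ring (int i - 1)))"
proof -
  let ?g = "\<lambda>i. of_int_mod_ring (int i - 1) :: 'n mod_ring"
  have rep: "to_int_mod_ring (?g i) = int i - 1" if "i \<in> {1..CARD('n)}" for i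
    using that by (intro to_int_mod_ring_of_int_mod_ring) auto
  have inj: "?g i = ?g j \<longleftrightarrow> i = j" if "i \<in> {1..CARD('n)}" "j \<in> {1..CARD('n)}" for i j
  proof
    assume "?g i = ?g j"
    then have "int i - 1 = int j - 1" using rep[OF that(1)] rep[OF that(2)] by metis
    then show "i = j" by linarith
  qed simp
  have surj: "\<exists>i\<in>{1..CARD('n)}. g = ?g i" for g
  proof -
    have "to_int_mod_ring g \<in> {0..<int CARD('n)}"
      using range_to_int_mod_ring[where 'a='n] by blast
    then show ?thesis
      by (intro bexI[of _ "nat (to_int_mod_ring g) + 1"]) (simp_all, linarith)
  qed
  have scale: "scale_alg (c i) (basis_elt i) = Poly_Mapping.single (?g i) (c i)" for i
    by (rule poly_mapping_eqI)
      (simp add: lookup_scale_alg basis_elt_def lookup_single when_def)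
  have look: "Poly_Mapping.lookup (\<Sum>i=1..CARD('n). scale_alg (c i) (basis_elt i)) (?g j) = c j"
    if j: "j \<in> {1..CARD('n)}" for j
  proof -
    have "Poly_Mapping.lookup (\<Sum>i=1..CARD('n). scale_alg (c i) (basis_elt i)) (?g j)
        = (\<Sum>i=1..CARD('n). if i = j then c i else 0)"
      unfolding lookup_sum scale using inj j
      by (intro sum.cong) (auto simp: lookup_single when_def)
    then show ?thesis using j by simp
  qed
  show ?thesis (is "x = ?s \<longleftrightarrow> ?r")
  proof
    assume "x = ?s"
    then show ?r using look by simp
  next
    assume r: ?r
    show "x = ?s"
    proof (rule poly_mapping_eqI)
      fix g
      obtain j where j: "j \<in> {1..CARD('n)}" "g = ?g j" using surj by blast
      show "Poly_Mapping.lookup x g = Poly_Mapping.lookup ?s g"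
        using r look[OF j(1)] j by simp
    qed
  qed
qed

text \<open>
  The rows and columns numbered \<open>i = 1, \<dots>, n\<close> on paper are labelled here by the residue classes
  of \<open>i - 1\<close>. The subscript \<open>j - i + 1\<close>, reduced to the range \<open>1, \<dots>, n\<close>, is one more than the
  least nonnegative representative of the class of \<open>j - i\<close>.
\<close>

definition circ :: "(nat \<Rightarrow> 'a) \<Rightarrow> 'a ^ ('n::finite mod_ring) ^ ('n mod_ring)"
  where "circ c = (\<chi> i j. c (nat (to_int_mod_ring (j - i)) + 1))"

lemma circ_entry:
  assumes "i \<in> {1..CARD('n)}" "j \<in> {1..CARD('n)}"
  shows "(circ c :: 'a ^ ('n::finite mod_ring) ^ ('n mod_ring))
    $ of_int_mod_ring (int i - 1) $ of_int_mod_ring (int j - 1)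
    = c (nat ((int j - int i) mod int CARD('n)) + 1)"
proof -
  have "to_int_mod_ring (of_int_mod_ring (int j - 1) - of_int_mod_ring (int i - 1) :: 'n mod_ring)
      = (int j - int i) mod int CARD('n)"
    by (transfer, simp add: mod_diff_eq)
  then show ?thesis by (simp add: circ_def)
qed

definition linear_form :: "(('n::finite, 'a::field) cyclic_algebra \<Rightarrow> 'a) \<Rightarrow> bool"
  where "linear_form f \<longleftrightarrow> Vector_Spaces.linear scale_alg (*) f"

text \<open>
  A \<open>d\<close>-form is a homogeneous polynomial of degree \<open>d\<close> in the coordinates; \<open>m\<close> ranges over the
  exponent vectors of the monomials of degree \<open>d\<close>, and \<open>a m\<close> is the coefficient of such a monomial.
\<close>

definition d_form :: "nat \<Rightarrow> (('n::finite, 'a::field) cyclic_algebra \<Rightarrow> 'a) \<Rightarrow> bool"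
  where "d_form d f \<longleftrightarrow> (\<exists>a :: ('n mod_ring \<Rightarrow> nat) \<Rightarrow> 'a. \<forall>x.
    f x = (\<Sum>m | (\<Sum>g\<in>UNIV. m g) = d. a m * (\<Prod>g\<in>UNIV. Poly_Mapping.lookup x g ^ m g)))"

definition form_poly :: "nat \<Rightarrow> (nat \<Rightarrow> 'a::field) \<Rightarrow> 'a poly"
  where "form_poly n q = Polynomial.monom 1 n + (\<Sum>k=1..n. Polynomial.monom ((-1) ^ k * q k) (n - k))"

end

theory Submission
  imports Defs
begin

text \<open>
  The polynomial that \<open>x\<close> satisfies is the characteristic polynomial of its circulant matrix \<open>C\<close>,
  and \<open>(-1)\<^sup>k q\<^sub>k(x)\<close> is the coefficient of \<open>X\<^bsup>n-k\<^esup>\<close> in it. Since \<open>C\<close> is the matrix of multiplication by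
  \<open>x\<close>, the root property is an instance of the Cayley--Hamilton theorem, but the commutativity of the
  group algebra \<open>A\<close> gives it at once. Over \<open>A\<close>, the equations
  \<open>\<Sum>\<^sub>j C\<^sub>i\<^sub>j g\<^sub>j = x g\<^sub>i\<close> between group elements say that the vector \<open>(g\<^sub>1, \<dots>, g\<^sub>n)\<close> lies in the kernel
  of \<open>x I - C\<close>. The determinant of a square matrix over a commutative ring kills every coordinate of
  a kernel vector (\<open>det_mult_kernel_vector\<close>); one coordinate here is the identity of the group, so
  \<open>det (x I - C) = 0\<close> in \<open>A\<close>. Evaluation at \<open>x\<close> is a ring homomorphism from polynomials to \<open>A\<close> and
  commutes with determinants, so this determinant is the value at \<open>x\<close> of the characteristic
  polynomial (\<open>circulant_characteristic_poly_root\<close>).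

  The coefficients are read off from the Leibniz formula. A permutation other than the identity
  moves at least two points, so only the diagonal product reaches the degrees \<open>n\<close> and \<open>n - 1\<close>; it
  gives \<open>1\<close> and minus the trace. The constant coefficient is \<open>det (-C) = (-1)\<^sup>n det C\<close>. The trace is
  linear in \<open>x\<close>, and each Leibniz term of \<open>det C\<close> is a product of \<open>n\<close> coordinates of \<open>x\<close>, so the
  determinant is an \<open>n\<close>-form (\<open>d_form_sum_prod\<close>).
\<close>

section \<open>Determinants over commutative rings\<close>

lemma det_comm_ring_hom:
  fixes A :: "'a::comm_ring_1 ^ 'n ^ 'n" and h :: "'a \<Rightarrow> 'b::comm_ring_1"
  assumes "comm_ring_hom h"
  shows "h (det A) = det (\<chi> i j. h (A $ i $ j))"
proof -
  interpret comm_ring_hom h by fact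
  show ?thesis unfolding Determinants.det_def by (simp add: hom_distribs)
qed

lemma det_uminus:
  fixes A :: "'a::comm_ring_1 ^ 'n ^ 'n"
  shows "det (\<chi> i j. - (A $ i $ j)) = (- 1) ^ CARD('n) * det A"
proof -
  have "(\<chi> i j. - (A $ i $ j)) = (\<chi> i. (- 1) *s (A $ i))"
    by (simp add: vec_eq_iff)
  then show ?thesis by (simp add: det_rows_mul)
qed

text \<open>
  The adjugate argument, phrased by rows of the transpose \<open>B\<close>: if row \<open>k\<close> of \<open>B\<close> is replaced by the
  vanishing combination \<open>\<Sum>\<^sub>j v\<^sub>j B\<^sub>j\<close>, the determinant is \<open>0\<close>. Expanding it linearly in that row, every
  term with \<open>j \<noteq> k\<close> has a repeated row, and the remaining term is \<open>v\<^sub>k det B\<close>. No division occurs, which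
  is essential: the group algebra has zero divisors.
\<close>

lemma det_mult_kernel_vector:
  fixes A :: "'a::comm_ring_1 ^ 'n ^ 'n"
  assumes "A *v v = 0"
  shows "det A * v $ k = 0"
proof -
  define B where "B = transpose A"
  let ?replace = "\<lambda>r. det (\<chi> i. if i = k then r else B $ i)"
  have rows: "(\<Sum>j\<in>UNIV. v $ j *s B $ j) = 0"
    using assms
    by (simp add: B_def vec_eq_iff transpose_def matrix_vector_mult_def mult.commute)
  have other: "?replace (B $ j) = 0" if "j \<noteq> k" for j
    by (rule det_identical_rows[of k j]) (use that in \<open>auto simp: row_def\<close>)
  have same: "?replace (B $ k) = det B"
    by (rule arg_cong[where f = det]) (simp add: vec_eq_iff)
  have "0 = ?replace (\<Sum>j\<in>UNIV. v $ j *s B $ j)"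
    unfolding rows by (rule det_row_0[symmetric])
  also have "\<dots> = (\<Sum>j\<in>UNIV. ?replace (v $ j *s B $ j))"
    by (rule det_linear_row_sum) simp
  also have "\<dots> = (\<Sum>j\<in>UNIV. v $ j * ?replace (B $ j))"
    by (simp only: det_row_mul)
  also have "\<dots> = (\<Sum>j\<in>UNIV. if j = k then v $ k * det B else 0)"
    by (intro sum.cong) (auto simp: other same)
  also have "\<dots> = det A * v $ k"
    by (simp add: B_def mult.commute)
  finally show ?thesis by simp
qed

section \<open>The characteristic polynomial\<close>

definition characteristic_poly :: "'a::comm_ring_1 ^ 'n ^ 'n \<Rightarrow> 'a poly"
  where "characteristic_poly A = det (\<chi> i j. (if i = j then [:0, 1:] else 0) - [:A $ i $ j:])"

lemma comm_ring_hom_eval: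
  fixes h :: "'a::comm_ring_1 \<Rightarrow> 'b::comm_ring_1"
  assumes "comm_ring_hom h"
  shows "comm_ring_hom (\<lambda>p. poly (map_poly h p) s)"
proof -
  interpret h: comm_ring_hom h by fact
  interpret map_poly_comm_ring_hom h ..
  show ?thesis by unfold_locales (simp_all add: hom_distribs)
qed

lemma eval_characteristic_poly:
  fixes h :: "'a::comm_ring_1 \<Rightarrow> 'b::comm_ring_1"
  assumes "comm_ring_hom h"
  shows "poly (map_poly h (characteristic_poly A)) s
    = det (\<chi> i j. (if i = j then s else 0) - h (A $ i $ j))"
proof -
  interpret h: comm_ring_hom h by fact
  interpret e: comm_ring_hom "\<lambda>p. poly (map_poly h p) s"
    by (rule comm_ring_hom_eval) fact
  show ?thesis
    unfolding characteristic_poly_def det_comm_ring_hom[OF e.comm_ring_hom_axioms]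
    by (intro arg_cong[where f = det]) (simp add: vec_eq_iff e.hom_minus h.map_poly_pCons_hom)
qed

text \<open>
  Here \<open>v\<close> is an eigenvector of \<open>A\<close> with eigenvalue \<open>s\<close>, after extension of scalars along \<open>h\<close>. When
  some coordinate of \<open>v\<close> is a unit, \<open>s\<close> is a root of the characteristic polynomial.
\<close>

lemma characteristic_poly_annihilates_eigenvector:
  fixes h :: "'a::comm_ring_1 \<Rightarrow> 'b::comm_ring_1" and A :: "'a ^ 'n ^ 'n"
  assumes "comm_ring_hom h"
    and eigen: "\<And>i. (\<Sum>j\<in>UNIV. h (A $ i $ j) * v $ j) = s * v $ i"
  shows "poly (map_poly h (characteristic_poly A)) s * v $ k = 0"
proof -
  have "(\<chi> i j. (if i = j then s else 0) - h (A $ i $ j)) *v v = 0"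
    by (simp add: vec_eq_iff matrix_vector_mult_def left_diff_distrib sum_subtractf eigen
        if_distrib[where f = "\<lambda>t. t * _"] cong: if_cong)
  then show ?thesis
    unfolding eval_characteristic_poly[OF assms(1)] by (rule det_mult_kernel_vector)
qed

lemma coeff_0_characteristic_poly:
  fixes A :: "'a::comm_ring_1 ^ 'n ^ 'n"
  shows "poly.coeff (characteristic_poly A) 0 = (- 1) ^ CARD('n) * det A"
proof -
  \<comment> \<open>Evaluating at \<open>s = 0\<close> along the identity turns the defining determinant into that of \<open>- A\<close>.\<close>
  have "comm_ring_hom (\<lambda>a :: 'a. a)" by unfold_locales simp_all
  from eval_characteristic_poly[OF this, of A 0] show ?thesis
    by (simp add: poly_0_coeff_0 det_uminus)
qed

lemma prod_linear_factors:
  fixes a :: "'i \<Rightarrow> 'a::comm_ring_1"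
  assumes "finite S"
  shows "degree (\<Prod>i\<in>S. [:- a i, 1:]) \<le> card S"
    and "poly.coeff (\<Prod>i\<in>S. [:- a i, 1:]) (card S) = 1"
    and "S \<noteq> {} \<Longrightarrow> poly.coeff (\<Prod>i\<in>S. [:- a i, 1:]) (card S - 1) = - (\<Sum>i\<in>S. a i)"
proof -
  have deg: "degree (\<Prod>i\<in>S. [:- a i, 1:]) \<le> card S" if "finite S" for S
  proof -
    have "degree (\<Prod>i\<in>S. [:- a i, 1:]) \<le> (\<Sum>i\<in>S. degree [:- a i, 1:])"
      using degree_prod_sum_le[OF that, of "\<lambda>i. [:- a i, 1:]"] by (simp add: o_def)
    then show ?thesis by simp
  qed
  have lead: "poly.coeff (\<Prod>i\<in>S. [:- a i, 1:]) (card S) = 1" if "finite S" for S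
    using that
  proof induction
    case (insert x S)
    then show ?case
      using deg[OF insert(1)] by (simp add: coeff_eq_0)
  qed simp
  have subleading: "S \<noteq> {} \<Longrightarrow> poly.coeff (\<Prod>i\<in>S. [:- a i, 1:]) (card S - 1) = - (\<Sum>i\<in>S. a i)"
    using assms
  proof induction
    case (insert x S)
    show ?case
    proof (cases "S = {}")
      case False
      then obtain m where m: "card S = Suc m"
        using insert(1) by (metis card_gt_0_iff gr0_implies_Suc)
      show ?thesis
        using insert False lead[OF insert(1)] by (simp add: m algebra_simps)
    qed simp
  qed simp
  show "degree (\<Prod>i\<in>S. [:- a i, 1:]) \<le> card S"
    "poly.coeff (\<Prod>i\<in>S. [:- a i, 1:]) (card S) = 1"
    "S \<noteq> {} \<Longrightarrow> poly.coeff (\<Prod>i\<in>S. [:- a i, 1:]) (card S - 1) = - (\<Sum>i\<in>S. a i)"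
    using deg lead subleading assms by blast+
qed

text \<open>
  The degree of a Leibniz term is at most the number of fixed points of its permutation. A
  permutation that moves \<open>i\<close> also moves the image of \<open>i\<close>, so every term but the diagonal one has
  degree at most \<open>n - 2\<close>.
\<close>

lemma coeff_characteristic_poly_diagonal:
  fixes A :: "'a::comm_ring_1 ^ 'n ^ 'n"
  assumes k: "CARD('n) - 1 \<le> k"
  shows "poly.coeff (characteristic_poly A) k = poly.coeff (\<Prod>i\<in>UNIV. [:- (A $ i $ i), 1:]) k"
proof -
  define M :: "'n \<Rightarrow> 'n \<Rightarrow> 'a poly"
    where "M i j = (if i = j then [:0, 1:] else 0) - [:A $ i $ j:]" for i j
  let ?t = "\<lambda>p. of_int (sign p) * (\<Prod>i\<in>UNIV. M i (p i))"
  have zero: "poly.coeff (?t p) k = 0" if p: "p permutes (UNIV :: 'n set)" "p \<noteq> id" for p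
  proof -
    obtain i where i: "p i \<noteq> i" using p(2) by (auto simp: fun_eq_iff)
    then have pi: "p (p i) \<noteq> p i" using permutes_inj[OF p(1)] by (simp add: inj_eq)
    have "degree (?t p) \<le> degree (\<Prod>i\<in>UNIV. M i (p i))"
      using degree_mult_le[of "of_int (sign p)" "\<Prod>i\<in>UNIV. M i (p i)"] by simp
    also have "\<dots> \<le> (\<Sum>i\<in>UNIV. degree (M i (p i)))"
      using degree_prod_sum_le[of UNIV "\<lambda>i. M i (p i)"] by (simp add: o_def)
    also have "\<dots> \<le> (\<Sum>i\<in>UNIV. if p i = i then 1 else 0)"
      by (intro sum_mono) (auto simp: M_def)
    also have "\<dots> = card {i. p i = i}"
      by (simp add: sum.If_cases)
    also have "\<dots> \<le> card (UNIV - {i, p i})"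
      by (intro card_mono) (use i pi in auto)
    also have "\<dots> = CARD('n) - 2"
      using i by (simp add: card_Diff_subset)
    finally have "degree (?t p) \<le> CARD('n) - 2" .
    moreover have "2 \<le> CARD('n)"
      using i card_mono[of UNIV "{i, p i}"] by simp
    ultimately have "degree (?t p) < k" using k by linarith
    then show ?thesis by (rule coeff_eq_0)
  qed
  have "poly.coeff (characteristic_poly A) k = (\<Sum>p | p permutes (UNIV :: 'n set). poly.coeff (?t p) k)"
    by (simp add: characteristic_poly_def Determinants.det_def M_def coeff_sum)
  also have "\<dots> = (\<Sum>p\<in>{id}. poly.coeff (?t p) k)"
    by (rule sum.mono_neutral_right) (auto simp: zero permutes_id finite_permutations)
  also have "\<dots> = poly.coeff (\<Prod>i\<in>UNIV. [:- (A $ i $ i), 1:]) k"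
    by (simp add: M_def)
  finally show ?thesis .
qed

lemma degree_characteristic_poly_le:
  fixes A :: "'a::comm_ring_1 ^ 'n ^ 'n"
  shows "degree (characteristic_poly A) \<le> CARD('n)"
proof (rule degree_le, intro allI impI)
  fix k assume "CARD('n) < k"
  then show "poly.coeff (characteristic_poly A) k = 0"
    using prod_linear_factors(1)[of "UNIV :: 'n set" "\<lambda>i. A $ i $ i"]
    by (simp add: coeff_characteristic_poly_diagonal coeff_eq_0)
qed

lemma monic_characteristic_poly:
  fixes A :: "'a::comm_ring_1 ^ 'n ^ 'n"
  shows "poly.coeff (characteristic_poly A) CARD('n) = 1"
  using prod_linear_factors(2)[of "UNIV :: 'n set" "\<lambda>i. A $ i $ i"]
  by (simp add: coeff_characteristic_poly_diagonal)

lemma coeff_characteristic_poly_trace: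
  fixes A :: "'a::comm_ring_1 ^ 'n ^ 'n"
  shows "poly.coeff (characteristic_poly A) (CARD('n) - 1) = - trace A"
  using prod_linear_factors(3)[of "UNIV :: 'n set" "\<lambda>i. A $ i $ i"]
  by (simp add: coeff_characteristic_poly_diagonal trace_def)

lemma form_poly_signed_coeffs:
  fixes p :: "'a::field poly"
  assumes "degree p \<le> n" "poly.coeff p n = 1"
  shows "form_poly n (\<lambda>k. (- 1) ^ k * poly.coeff p (n - k)) = p"
proof -
  have "(\<Sum>k=1..n. Polynomial.monom ((- 1) ^ k * ((- 1) ^ k * poly.coeff p (n - k))) (n - k))
      = (\<Sum>k=1..n. Polynomial.monom (poly.coeff p (n - k)) (n - k))"
    by (simp add: mult.assoc[symmetric] power_mult_distrib[symmetric])
  also have "\<dots> = (\<Sum>i<n. Polynomial.monom (poly.coeff p i) i)"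
    by (rule sum.reindex_bij_witness[where i = "\<lambda>i. n - i" and j = "\<lambda>k. n - k"]) auto
  finally have "form_poly n (\<lambda>k. (- 1) ^ k * poly.coeff p (n - k))
      = (\<Sum>i\<le>n. Polynomial.monom (poly.coeff p i) i)"
    using assms(2) by (simp add: form_poly_def lessThan_Suc_atMost[symmetric])
  then show ?thesis using poly_as_sum_of_monoms'[OF assms(1)] by simp
qed

section \<open>Forms in the coordinates\<close>

lemma finite_exponents_of_degree: "finite {m :: 'g::finite \<Rightarrow> nat. (\<Sum>g\<in>UNIV. m g) = d}"
proof (rule finite_subset)
  show "{m :: 'g \<Rightarrow> nat. (\<Sum>g\<in>UNIV. m g) = d} \<subseteq> PiE UNIV (\<lambda>_. {..d})"
    by (auto simp: PiE_UNIV_domain intro: member_le_sum)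
  show "finite (PiE (UNIV :: 'g set) (\<lambda>_. {..d}))"
    by (intro finite_PiE) auto
qed

text \<open>
  A product of coordinates \<open>w p i\<close> is the monomial in which the exponent of the coordinate \<open>g\<close> is the
  number of indices \<open>i\<close> with \<open>w p i = g\<close>. Different \<open>p\<close> may give the same monomial, whose coefficient is
  then the sum of their scalars.
\<close>

lemma d_form_sum_prod:
  fixes f :: "('n::finite, 'a::field) cyclic_algebra \<Rightarrow> 'a"
  assumes fin: "finite P" "finite I"
    and f: "\<And>x. f x = (\<Sum>p\<in>P. s p * (\<Prod>i\<in>I. Poly_Mapping.lookup x (w p i)))"
  shows "d_form (card I) f"
proof -
  define \<mu> where "\<mu> p g = card {i \<in> I. w p i = g}" for p g
  define a where "a m = (\<Sum>p | p \<in> P \<and> \<mu> p = m. s p)" for m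
  let ?M = "{m. (\<Sum>g\<in>UNIV. m g) = card I}"
  have monomial: "(\<Prod>i\<in>I. Poly_Mapping.lookup x (w p i))
      = (\<Prod>g\<in>UNIV. Poly_Mapping.lookup x g ^ \<mu> p g)" for x :: "('n, 'a) cyclic_algebra" and p
  proof -
    have "(\<Prod>i\<in>I. Poly_Mapping.lookup x (w p i))
        = (\<Prod>g\<in>UNIV. \<Prod>i | i \<in> I \<and> w p i = g. Poly_Mapping.lookup x (w p i))"
      by (rule prod.group[symmetric]) (use fin in auto)
    also have "\<dots> = (\<Prod>g\<in>UNIV. Poly_Mapping.lookup x g ^ \<mu> p g)"
      by (simp add: \<mu>_def)
    finally show ?thesis .
  qed
  have \<mu>: "\<mu> p \<in> ?M" for p
    using sum.group[of I "UNIV :: 'n mod_ring set" "w p" "\<lambda>_. 1 :: nat"] fin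
    by (simp add: \<mu>_def)
  have "f x = (\<Sum>m\<in>?M. a m * (\<Prod>g\<in>UNIV. Poly_Mapping.lookup x g ^ m g))" for x
  proof -
    have "f x = (\<Sum>p\<in>P. s p * (\<Prod>g\<in>UNIV. Poly_Mapping.lookup x g ^ \<mu> p g))"
      by (simp add: f monomial)
    also have "\<dots> = (\<Sum>m\<in>?M. \<Sum>p | p \<in> P \<and> \<mu> p = m.
        s p * (\<Prod>g\<in>UNIV. Poly_Mapping.lookup x g ^ \<mu> p g))"
      by (rule sum.group[symmetric]) (use fin finite_exponents_of_degree \<mu> in auto)
    also have "\<dots> = (\<Sum>m\<in>?M. a m * (\<Prod>g\<in>UNIV. Poly_Mapping.lookup x g ^ m g))"
      by (simp add: a_def sum_distrib_right)
    finally show ?thesis .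
  qed
  then show ?thesis unfolding d_form_def by blast
qed

section \<open>Multiplication in the group algebra as a circulant matrix\<close>

text \<open>
  The circulant matrix is expressed through the coordinates of \<open>x\<close> at residue classes, so that the
  index arithmetic is subtraction in the group itself.
\<close>

definition circulant :: "('n::finite, 'a::comm_ring_1) cyclic_algebra \<Rightarrow> 'a ^ ('n mod_ring) ^ ('n mod_ring)"
  where "circulant x = (\<chi> i j. Poly_Mapping.lookup x (j - i))"

lemma circ_eq_circulant:
  fixes x :: "('n::finite, 'a::comm_ring_1) cyclic_algebra"
  assumes "x = (\<Sum>i=1..CARD('n). scale_alg (c i) (basis_elt i))"
  shows "circ c = circulant x"
proof -
  have "c (nat (to_int_mod_ring g) + 1) = Poly_Mapping.lookup x g" for g :: "'n mod_ring"
  proof -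
    have "to_int_mod_ring g \<in> {0..<int CARD('n)}"
      using range_to_int_mod_ring[where 'a = 'n] by blast
    then have "nat (to_int_mod_ring g) + 1 \<in> {1..CARD('n)}" "0 \<le> to_int_mod_ring g"
      by auto
    then show ?thesis
      using assms[unfolded basis_elt_expansion] by simp
  qed
  then show ?thesis by (simp add: circ_def circulant_def)
qed

lemma comm_ring_hom_scalar:
  "comm_ring_hom (Poly_Mapping.single 0 :: 'a::comm_ring_1 \<Rightarrow> ('n::finite, 'a) cyclic_algebra)"
  by unfold_locales (simp_all add: single_add mult_single)

text \<open>
  Row \<open>i\<close> of the circulant matrix lists the coordinates of the product of \<open>x\<close> with the group
  element \<open>i\<close>. Read over the group algebra, the vector of all group elements is thus an eigenvector with eigenvalue \<open>x\<close>.
\<close>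

lemma circulant_eigenvector:
  fixes x :: "('n::finite, 'a::comm_ring_1) cyclic_algebra"
  shows "(\<Sum>j\<in>UNIV. Poly_Mapping.single 0 (circulant x $ i $ j) * Poly_Mapping.single j 1)
    = x * Poly_Mapping.single i 1"
proof -
  have x: "x = (\<Sum>g\<in>UNIV. Poly_Mapping.single g (Poly_Mapping.lookup x g))"
    by (rule poly_mapping_eqI) (simp add: lookup_sum lookup_single when_def)
  have "x * Poly_Mapping.single i 1
      = (\<Sum>g\<in>UNIV. Poly_Mapping.single (g + i) (Poly_Mapping.lookup x g))"
    by (subst x) (simp add: sum_distrib_right mult_single)
  also have "\<dots> = (\<Sum>j\<in>UNIV. Poly_Mapping.single j (Poly_Mapping.lookup x (j - i)))"
    by (rule sum.reindex_bij_witness[where i = "\<lambda>j. j - i" and j = "\<lambda>g. g + i"]) auto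
  finally show ?thesis by (simp add: circulant_def mult_single)
qed

lemma circulant_characteristic_poly_root:
  fixes x :: "('n::finite, 'a::comm_ring_1) cyclic_algebra"
  shows "poly (map_poly (Poly_Mapping.single 0) (characteristic_poly (circulant x))) x = 0"
proof -
  let ?v = "(\<chi> j. Poly_Mapping.single j 1) :: ('n, 'a) cyclic_algebra ^ ('n mod_ring)"
  \<comment> \<open>The coordinate at the residue class \<open>0\<close> is the unit of the group algebra.\<close>
  have "poly (map_poly (Poly_Mapping.single 0) (characteristic_poly (circulant x))) x * ?v $ 0 = 0"
    by (rule characteristic_poly_annihilates_eigenvector[OF comm_ring_hom_scalar])
      (simp add: circulant_eigenvector)
  then show ?thesis by simp
qed

lemma trace_circulant:
  fixes x :: "('n::finite, 'a::comm_ring_1) cyclic_algebra"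
  shows "trace (circulant x) = of_nat CARD('n) * Poly_Mapping.lookup x 0"
  by (simp add: trace_def circulant_def)

lemma linear_form_trace_circulant:
  "linear_form (\<lambda>x :: ('n::finite, 'a::field) cyclic_algebra. trace (circulant x))"
proof -
  interpret A: vector_space "scale_alg :: 'a \<Rightarrow> _ \<Rightarrow> ('n, 'a) cyclic_algebra"
    by (rule vector_space_scale_alg)
  interpret K: vector_space "(*) :: 'a \<Rightarrow> 'a \<Rightarrow> 'a"
    by unfold_locales (simp_all add: algebra_simps)
  show ?thesis
    unfolding linear_form_def trace_circulant
    by unfold_locales (simp_all add: lookup_add lookup_scale_alg algebra_simps)
qed

lemma d_form_det_circulant:
  "d_form CARD('n) (\<lambda>x :: ('n::finite, 'a::field) cyclic_algebra. det (circulant x))"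
proof -
  have "d_form (card (UNIV :: 'n mod_ring set))
    (\<lambda>x :: ('n, 'a) cyclic_algebra. det (circulant x))"
    by (rule d_form_sum_prod[where P = "{p. p permutes UNIV}" and s = "\<lambda>p. of_int (sign p)"
          and w = "\<lambda>p i. p i - i"])
      (simp_all add: Determinants.det_def circulant_def finite_permutations)
  then show ?thesis by simp
qed

theorem corollary2p2:
  shows "\<exists>q :: nat \<Rightarrow> ('n::finite, 'a::field_char_0) cyclic_algebra \<Rightarrow> 'a.
    linear_form (q 1) \<and>
    d_form CARD('n) (q CARD('n)) \<and>
    (\<forall>x.
      poly (map_poly (Poly_Mapping.single 0) (form_poly CARD('n) (\<lambda>k. q k x))) x = 0 \<and>
      (\<forall>c :: nat \<Rightarrow> 'a. x = (\<Sum>i=1..CARD('n). scale_alg (c i) (basis_elt i)) \<longrightarrow>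
        q 1 x = trace (circ c :: 'a ^ ('n mod_ring) ^ ('n mod_ring)) \<and>
        trace (circ c :: 'a ^ ('n mod_ring) ^ ('n mod_ring)) = of_nat CARD('n) * c 1 \<and>
        q CARD('n) x = det (circ c :: 'a ^ ('n mod_ring) ^ ('n mod_ring))))"
proof -
  define p :: "('n, 'a) cyclic_algebra \<Rightarrow> 'a poly"
    where "p x = characteristic_poly (circulant x)" for x
  define q :: "nat \<Rightarrow> ('n, 'a) cyclic_algebra \<Rightarrow> 'a"
    where "q k x = (- 1) ^ k * poly.coeff (p x) (CARD('n) - k)" for k x
  have q_1: "q 1 = (\<lambda>x. trace (circulant x))"
    using coeff_characteristic_poly_trace[where 'a = 'a and 'n = "'n mod_ring"]
    by (simp add: q_def p_def fun_eq_iff)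
  have q_n: "q CARD('n) = (\<lambda>x. det (circulant x))"
    by (simp add: q_def p_def fun_eq_iff coeff_0_characteristic_poly
        mult.assoc[symmetric] power_mult_distrib[symmetric])
  have "form_poly CARD('n) (\<lambda>k. q k x) = p x" for x
    unfolding q_def p_def
    using degree_characteristic_poly_le[of "circulant x"]
      monic_characteristic_poly[of "circulant x"]
    by (intro form_poly_signed_coeffs) simp_all
  then have root:
    "poly (map_poly (Poly_Mapping.single 0) (form_poly CARD('n) (\<lambda>k. q k x))) x = 0" for x
    by (simp add: p_def circulant_characteristic_poly_root)
  have trace: "trace (circ c :: 'a ^ ('n mod_ring) ^ ('n mod_ring)) = of_nat CARD('n) * c 1" for c
    by (simp add: trace_def circ_def)
  show ?thesis
  proof (intro exI[of _ q] conjI allI impI)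
    show "linear_form (q 1)" unfolding q_1 by (rule linear_form_trace_circulant)
    show "d_form CARD('n) (q CARD('n))" unfolding q_n by (rule d_form_det_circulant)
    fix x :: "('n, 'a) cyclic_algebra" and c :: "nat \<Rightarrow> 'a"
    show "poly (map_poly (Poly_Mapping.single 0) (form_poly CARD('n) (\<lambda>k. q k x))) x = 0"
      by (rule root)
    show "trace (circ c :: 'a ^ ('n mod_ring) ^ ('n mod_ring)) = of_nat CARD('n) * c 1"
      by (rule trace)
    assume "x = (\<Sum>i=1..CARD('n). scale_alg (c i) (basis_elt i))"
    from circ_eq_circulant[OF this]
    show "q 1 x = trace (circ c :: 'a ^ ('n mod_ring) ^ ('n mod_ring))"
      and "q CARD('n) x = det (circ c :: 'a ^ ('n mod_ring) ^ ('n mod_ring))"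
      unfolding q_1 q_n by simp_all
  qed
qed

end
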